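(* Let $G$ be a locally finite infinite graph with a nested set $\mathcal{C}$ of regions defining a basis of $|G|$, and let $k \in \mathbb{N}$ and $q \in \mathbb{Q}$. (i) If $\delta(G) \geq k$ and $\delta_G^+(C) \geq k$ for every $C \in \mathcal{C}$, then $G$ has a finite subgraph of minimum degree $\geq k$. (ii) If there is a finite set $S_0\subseteq V(G)$ such that $d_G(S) \geq q$ for every finite set $S \subseteq V(G)$ containing $S_0$, and $d_G^+(C) > q$ for every $C \in \mathcal{C}$, then $G$ has a finite subgraph of average degree $> q$.
   Context: An end of $G$ is an equivalence class of rays of $G$, two rays being equivalent if no finite vertex set separates them; an end lives in a subgraph $C$ if each of its rays has a tail in $C$. $|G|$ denotes the Freudenthal compactification of the locally finite graph $G$ (the 1-complex $G$ together with its ends, with the standard topology). For a subgraph or vertex set $U$, $V^+(U)$ is the set of vertices of $U$ having a neighbour outside $U$; for finite $U$, $d_G(U) := \sum_{v\in U} d_G(v)/|U|$. A region of $G$ is a connected induced subgraph $C$ with $V^+(C)$ finite; with $S := N(C)$ (vertices outside $C$ adjacent to $C$), $G[S,C] := G[S\cup V^+(C)]$, $\delta_G^+(C) := \min_{v\in V^+(C)} d_{G[S,C]}(v)$ and $d_G^+(C) :=$ the average of $d_{G[S,C]}(v)$ over $v\in V^+(C)$. For a region $C$, $\hat C$ denotes the open subset of $|G|$ consisting of $C$, the ends living in $C$, and the inner points of edges between $C$ and $G-C$. A set $\mathcal{C}$ of regions is nested if any two members are either disjoint or one contains the other. $\mathcal{C}$ defines a basis of $|G|$ if the sets $\hat C$,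 $C\in\mathcal{C}$, together with the open stars around vertices and the open intervals of edges, form a basis of the topology of $|G|$. The paper phrases the hypothesis of (ii) as "$d_G(S)\ge q$ for every large enough finite set $S$", explained as meaning all finite $S$ containing some given finite $S_0$.
   Formalization: In (ii) G is assumed to have only finitely many components, as is implicit in |G| being compact; without this, infinitely many disjoint triangles with empty 𝒞 and q = 2 are a counterexample. *)

theory Defs
  imports "HOL-Analysis.Function_Topology"
begin

section \<open>Simple graphs\<close>

record 'a graph =
  verts :: "'a set"
  edges :: "'a set set"

definition simple_graph :: "'a graph \<Rightarrow> bool" where
  "simple_graph G \<longleftrightarrow> (\<forall>e\<in>edges G. e \<subseteq> verts G \<and> card e = 2)"

definition subgraph :: "'a graph \<Rightarrow> 'a graph \<Rightarrow> bool" where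
  "subgraph H G \<longleftrightarrow> simple_graph H \<and> verts H \<subseteq> verts G \<and> edges H \<subseteq> edges G"

definition induced :: "'a graph \<Rightarrow> 'a set \<Rightarrow> 'a graph" where
  "induced G U = \<lparr>verts = verts G \<inter> U, edges = {e \<in> edges G. e \<subseteq> U}\<rparr>"

definition neighbours :: "'a graph \<Rightarrow> 'a \<Rightarrow> 'a set" where
  "neighbours G v = {w. {v, w} \<in> edges G}"

definition locally_finite :: "'a graph \<Rightarrow> bool" where
  "locally_finite G \<longleftrightarrow> (\<forall>v\<in>verts G. finite (neighbours G v))"

definition degree :: "'a graph \<Rightarrow> 'a \<Rightarrow> nat" where
  "degree G v = card (neighbours G v)"

text \<open>Meaningful only for graphs with at least one vertex.\<close>

definition min_degree :: "'a graph \<Rightarrow> nat" where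
  "min_degree G = (INF v\<in>verts G. degree G v)"

text \<open>This is $d_G(U)$, for finite nonempty \<open>U\<close>. The degrees are taken in \<open>G\<close>, not in the
  subgraph induced by \<open>U\<close>; the average degree of a finite graph \<open>H\<close> is
  \<open>avg_degree_on H (verts H)\<close>.\<close>

definition avg_degree_on :: "'a graph \<Rightarrow> 'a set \<Rightarrow> rat" where
  "avg_degree_on G U = (\<Sum>v\<in>U. of_nat (degree G v)) / of_nat (card U)"

definition avg_degree :: "'a graph \<Rightarrow> rat" where
  "avg_degree G = avg_degree_on G (verts G)"

definition reachable :: "'a graph \<Rightarrow> 'a \<Rightarrow> 'a \<Rightarrow> bool" where
  "reachable G = (\<lambda>u v. {u, v} \<in> edges G)\<^sup>*\<^sup>*"

definition graph_connected :: "'a graph \<Rightarrow> bool" where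
  "graph_connected G \<longleftrightarrow> verts G \<noteq> {} \<and> (\<forall>u\<in>verts G. \<forall>v\<in>verts G. reachable G u v)"

text \<open>Components are represented by their vertex sets.\<close>

definition graph_components :: "'a graph \<Rightarrow> 'a set set" where
  "graph_components G = (\<lambda>u. {v. reachable G u v}) ` verts G"

section \<open>Rays and ends\<close>

definition ray :: "'a graph \<Rightarrow> (nat \<Rightarrow> 'a) \<Rightarrow> bool" where
  "ray G r \<longleftrightarrow> inj r \<and> (\<forall>n. {r n, r (Suc n)} \<in> edges G)"

definition has_tail_in :: "(nat \<Rightarrow> 'a) \<Rightarrow> 'a set \<Rightarrow> bool" where
  "has_tail_in r C \<longleftrightarrow> (\<exists>n. \<forall>m\<ge>n. r m \<in> C)"

definition separates_rays :: "'a graph \<Rightarrow> 'a set \<Rightarrow> (nat \<Rightarrow> 'a) \<Rightarrow> (nat \<Rightarrow> 'a) \<Rightarrow> bool" where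
  "separates_rays G S r s \<longleftrightarrow>
     (\<exists>C \<in> graph_components (induced G (verts G - S)).
      \<exists>D \<in> graph_components (induced G (verts G - S)).
        C \<noteq> D \<and> has_tail_in r C \<and> has_tail_in s D)"

definition ray_equiv :: "'a graph \<Rightarrow> ((nat \<Rightarrow> 'a) \<times> (nat \<Rightarrow> 'a)) set" where
  "ray_equiv G = {(r, s). ray G r \<and> ray G s \<and>
     \<not> (\<exists>S. finite S \<and> S \<subseteq> verts G \<and> separates_rays G S r s)}"

definition ends :: "'a graph \<Rightarrow> (nat \<Rightarrow> 'a) set set" where
  "ends G = {r. ray G r} // ray_equiv G"

definition lives_in :: "(nat \<Rightarrow> 'a) set \<Rightarrow> 'a set \<Rightarrow> bool" where
  "lives_in \<omega> C \<longleftrightarrow> (\<forall>r\<in>\<omega>. has_tail_in r C)"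

section \<open>The Freudenthal compactification\<close>

text \<open>Points of the 1-complex \<open>G\<close> are given by barycentric coordinates: a vertex \<open>v\<close> is the
  function with value 1 at \<open>v\<close> and 0 elsewhere, and an inner point of an edge $uv$ has support
  $\{u, v\}$ and two positive values with sum 1.\<close>

definition support :: "('a \<Rightarrow> real) \<Rightarrow> 'a set" where
  "support x = {v. x v \<noteq> 0}"

definition complex_points :: "'a graph \<Rightarrow> ('a \<Rightarrow> real) set" where
  "complex_points G = {x. (\<forall>v. 0 \<le> x v)
     \<and> ((\<exists>v\<in>verts G. support x = {v}) \<or> support x \<in> edges G)
     \<and> (\<Sum>v\<in>support x. x v) = 1}"

datatype 'a point = Pt "'a \<Rightarrow> real" | End "(nat \<Rightarrow> 'a) set"

text \<open>The star of radius \<open>\<epsilon>\<close>: a point on an edge $vw$ has distance $1 - x(v)$ from \<open>v\<close>.\<close>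

definition open_star :: "'a graph \<Rightarrow> 'a \<Rightarrow> real \<Rightarrow> 'a point set" where
  "open_star G v \<epsilon> = Pt ` {x \<in> complex_points G. 1 - x v < \<epsilon>}"

text \<open>\<open>u\<close> is an endvertex of \<open>e\<close> whose coordinate parametrises the edge.\<close>

definition open_edge_interval ::
    "'a graph \<Rightarrow> 'a set \<Rightarrow> 'a \<Rightarrow> real \<Rightarrow> real \<Rightarrow> 'a point set" where
  "open_edge_interval G e u a b =
     Pt ` {x \<in> complex_points G. support x = e \<and> a < x u \<and> x u < b}"

definition open_stars :: "'a graph \<Rightarrow> 'a point set set" where
  "open_stars G = {open_star G v \<epsilon> | v \<epsilon>. v \<in> verts G \<and> 0 < \<epsilon> \<and> \<epsilon> \<le> 1}"

definition open_edge_intervals :: "'a graph \<Rightarrow> 'a point set set" where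
  "open_edge_intervals G =
     {open_edge_interval G e u a b | e u a b. e \<in> edges G \<and> u \<in> e \<and> 0 \<le> a \<and> a < b \<and> b \<le> 1}"

text \<open>$\hat C$, for the induced subgraph on the vertex set \<open>C\<close>. The points of the 1-complex whose
  support meets \<open>C\<close> are the vertices in \<open>C\<close> and the inner points of all edges with at least one
  endvertex in \<open>C\<close>, that is, of the edges of $G[C]$ and of the edges between \<open>C\<close> and $G - C$.\<close>

definition hat :: "'a graph \<Rightarrow> 'a set \<Rightarrow> 'a point set" where
  "hat G C = Pt ` {x \<in> complex_points G. support x \<inter> C \<noteq> {}} \<union> End ` {\<omega> \<in> ends G. lives_in \<omega> C}"

text \<open>The basic open neighbourhoods of an end \<open>\<omega>\<close> are the sets $\hat C$ where \<open>C\<close> is the component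
  of $G - S$ in which \<open>\<omega>\<close> lives, for finite \<open>S\<close>. For locally finite \<open>G\<close> nothing changes if only
  initial segments of the edges from \<open>C\<close> to \<open>S\<close> are included.\<close>

definition end_neighbourhoods :: "'a graph \<Rightarrow> 'a point set set" where
  "end_neighbourhoods G =
     {hat G C | C S \<omega>. finite S \<and> S \<subseteq> verts G \<and> \<omega> \<in> ends G \<and>
        C \<in> graph_components (induced G (verts G - S)) \<and> lives_in \<omega> C}"

definition freudenthal :: "'a graph \<Rightarrow> 'a point topology" where
  "freudenthal G =
     topology_generated_by (open_stars G \<union> open_edge_intervals G \<union> end_neighbourhoods G)"

section \<open>Regions\<close>

text \<open>Regions, being induced subgraphs, are represented by their vertex sets.\<close>

definition inner_boundary :: "'a graph \<Rightarrow> 'a set \<Rightarrow> 'a set" ("V\<^sup>+") where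
  "V\<^sup>+ G U = {v \<in> U. neighbours G v - U \<noteq> {}}"

definition outer_boundary :: "'a graph \<Rightarrow> 'a set \<Rightarrow> 'a set" where
  "outer_boundary G C = {w \<in> verts G - C. neighbours G w \<inter> C \<noteq> {}}"

definition region :: "'a graph \<Rightarrow> 'a set \<Rightarrow> bool" where
  "region G C \<longleftrightarrow> C \<subseteq> verts G \<and> graph_connected (induced G C) \<and> finite (V\<^sup>+ G C)"

text \<open>$G[S, C]$ with $S = N(C)$.\<close>

definition boundary_graph :: "'a graph \<Rightarrow> 'a set \<Rightarrow> 'a graph" where
  "boundary_graph G C = induced G (outer_boundary G C \<union> V\<^sup>+ G C)"

text \<open>The minimum and the average are meaningful only if \<open>V\<^sup>+ G C\<close> is nonempty, that is, unless the
  region \<open>C\<close> is an entire component of \<open>G\<close>.\<close>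

definition min_boundary_degree :: "'a graph \<Rightarrow> 'a set \<Rightarrow> nat" ("\<delta>\<^sup>+") where
  "\<delta>\<^sup>+ G C = (INF v\<in>V\<^sup>+ G C. degree (boundary_graph G C) v)"

definition avg_boundary_degree :: "'a graph \<Rightarrow> 'a set \<Rightarrow> rat" ("d\<^sup>+") where
  "d\<^sup>+ G C = avg_degree_on (boundary_graph G C) (V\<^sup>+ G C)"

definition nested :: "'a set set \<Rightarrow> bool" where
  "nested \<C> \<longleftrightarrow> (\<forall>C\<in>\<C>. \<forall>D\<in>\<C>. C \<inter> D = {} \<or> C \<subseteq> D \<or> D \<subseteq> C)"

definition defines_basis :: "'a graph \<Rightarrow> 'a set set \<Rightarrow> bool" where
  "defines_basis G \<C> \<longleftrightarrow>
     openin (freudenthal G) =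
       arbitrary union_of (\<lambda>U. U \<in> hat G ` \<C> \<union> open_stars G \<union> open_edge_intervals G)"

end

theory Submission
  imports Defs
begin

text \<open>Finitely many members of \<open>\<C>\<close>, chosen to avoid a given finite vertex set, cover all but
  finitely many vertices of a component; by nestedness the maximal ones among them are disjoint.
  The remaining vertices together with the inner boundaries \<open>V\<^sup>+ G C\<close> of these regions induce a
  finite graph \<open>H\<close>: remaining vertices keep all their neighbours, and \<open>H\<close> contains $G[S,C]$ for
  every chosen \<open>C\<close>, because the neighbours of a region lie among the remaining vertices or on the
  inner boundary of another region.\<close>

section \<open>Adjacency and reachability\<close>

lemma simple_graph_edgeD:
  assumes "simple_graph G" "{u, v} \<in> edges G"
  shows "u \<in> verts G" "v \<in> verts G" "u \<noteq> v"
  using assms unfolding simple_graph_def by fastforce+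

lemma reachable_step: "reachable G u v \<Longrightarrow> {v, w} \<in> edges G \<Longrightarrow> reachable G u w"
  unfolding reachable_def by (rule rtranclp.rtrancl_into_rtrancl)

lemma reachable_trans: "reachable G u v \<Longrightarrow> reachable G v w \<Longrightarrow> reachable G u w"
  unfolding reachable_def by (rule rtranclp_trans)

lemma reachable_refl: "reachable G u u"
  unfolding reachable_def by simp

lemma reachable_sym: "reachable G u v \<Longrightarrow> reachable G v u"
proof -
  have "symp (\<lambda>u v. {u, v} \<in> edges G)"
    by (simp add: symp_def insert_commute)
  then show "reachable G u v \<Longrightarrow> reachable G v u"
    unfolding reachable_def by (blast dest: sympD[OF symp_rtranclp])
qed

lemma reachable_closed:
  assumes "reachable G u v" "u \<in> A" and "\<And>x y. x \<in> A \<Longrightarrow> {x, y} \<in> edges G \<Longrightarrow> y \<in> A"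
  shows "v \<in> A"
  using assms(1,2) unfolding reachable_def by (induction rule: rtranclp_induct) (simp, rule assms(3))

lemma reachable_in_verts:
  assumes "simple_graph G" "reachable G u v" "u \<in> verts G"
  shows "v \<in> verts G"
  using assms(2,3) by (rule reachable_closed) (rule simple_graph_edgeD(2)[OF assms(1)])

lemma simple_graph_induced: "simple_graph G \<Longrightarrow> simple_graph (induced G U)"
  by (auto simp: simple_graph_def induced_def)

lemma reachable_induced: "reachable (induced G U) u v \<Longrightarrow> reachable G u v"
  unfolding reachable_def by (erule rtranclp_mono[THEN predicate2D, rotated]) (auto simp: induced_def)

lemma graph_components_eqI:
  assumes "C \<in> graph_components G" "D \<in> graph_components G" "v \<in> C" "v \<in> D"
  shows "C = D"
proof -
  have "\<forall>w. reachable G u w \<longleftrightarrow> reachable G v w" if "reachable G u v" for u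
    using that by (meson reachable_trans reachable_sym)
  then show ?thesis
    using assms unfolding graph_components_def by auto
qed

lemma region_nonempty: "region G C \<Longrightarrow> C \<noteq> {}"
  by (auto simp: region_def graph_connected_def induced_def)

lemma region_reachable:
  assumes "region G C" "u \<in> C" "v \<in> C"
  shows "reachable G u v"
proof -
  have "u \<in> verts (induced G C)" "v \<in> verts (induced G C)"
    using assms by (auto simp: region_def induced_def)
  then show ?thesis
    using assms(1) by (meson graph_connected_def reachable_induced region_def)
qed

lemma mem_if_not_inner_boundary:
  "x \<in> C \<Longrightarrow> x \<notin> V\<^sup>+ G C \<Longrightarrow> {x, y} \<in> edges G \<Longrightarrow> y \<in> C"
  by (auto simp: inner_boundary_def neighbours_def)

section \<open>Regions at the end of a ray\<close>

text \<open>An injective ray meets the finite set \<open>X\<close> only finitely often; past its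
  last visit, consecutive vertices stay adjacent after \<open>X\<close> is deleted.\<close>

lemma ray_tail_in_component:
  assumes "simple_graph G" "ray G r" "finite X"
  obtains D where "D \<in> graph_components (induced G (verts G - X))" "has_tail_in r D"
proof -
  let ?G = "induced G (verts G - X)"
  have rv: "r n \<in> verts G" and re: "{r n, r (Suc n)} \<in> edges G" for n
    using assms(1,2) simple_graph_edgeD(1) unfolding ray_def by fast+
  have "finite (r -` X)"
    using assms(2,3) by (auto simp: ray_def intro: finite_vimageI)
  then obtain n where n: "\<forall>m\<in>r -` X. m < n"
    using finite_nat_set_iff_bounded by blast
  have "r m \<in> verts G - X" if "m \<ge> n" for m
    using n that rv[of m] by (auto simp: not_less[symmetric])
  then have e: "{r m, r (Suc m)} \<in> edges ?G" if "m \<ge> n" for m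
    using that re by (auto simp: induced_def)
  have "reachable ?G (r n) (r m)" if "m \<ge> n" for m
    using that by (induction rule: dec_induct) (rule reachable_refl, rule reachable_step[OF _ e])
  moreover have "r n \<in> verts ?G"
    using n rv by (auto simp: induced_def)
  ultimately show thesis
    by (intro that[of "{v. reachable ?G (r n) v}"])
       (auto simp: graph_components_def has_tail_in_def)
qed

lemma has_tail_in_common:
  assumes "has_tail_in r C" "has_tail_in r D"
  shows "\<exists>n. r n \<in> C \<and> r n \<in> D"
  using assms unfolding has_tail_in_def by (metis nle_le)

text \<open>Distinct components share no vertex, so one ray cannot have tails in two of them. This
  puts \<open>r\<close> into its own class.\<close>

lemma ray_equiv_refl: "ray G r \<Longrightarrow> (r, r) \<in> ray_equiv G"
  unfolding ray_equiv_def separates_rays_def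
  by (auto dest: graph_components_eqI has_tail_in_common)

text \<open>The vertices of \<open>C\<close> can be read off from \<open>hat G C\<close> as its
  points with singleton support.\<close>

lemma hat_subset_imp_subset:
  assumes "hat G C \<subseteq> hat G D" "C \<subseteq> verts G"
  shows "C \<subseteq> D"
proof
  fix v assume "v \<in> C"
  define x :: "'a \<Rightarrow> real" where "x = (\<lambda>u. if u = v then 1 else 0)"
  have s: "support x = {v}" by (auto simp: x_def support_def)
  have "x v = 1" by (simp add: x_def)
  then have "x \<in> complex_points G"
    using \<open>v \<in> C\<close> assms(2) s by (auto simp: complex_points_def x_def)
  then have "Pt x \<in> hat G C" using s \<open>v \<in> C\<close> by (auto simp: hat_def)
  then have "Pt x \<in> hat G D" using assms(1) by blast
  then show "v \<in> D" using s by (auto simp: hat_def)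
qed

text \<open>After deletion of \<open>X\<close>, the component holding a tail of \<open>r\<close>
  gives a neighbourhood of the end of \<open>r\<close>. A basis member around the end inside it
  comes from a region, which then avoids \<open>X\<close>.\<close>

lemma basis_region_of_ray:
  assumes G: "simple_graph G" and r: "ray G r" and X: "finite X" "X \<subseteq> verts G"
    and reg: "\<forall>C\<in>\<C>. region G C" and basis: "defines_basis G \<C>"
  obtains C where "C \<in> \<C>" "C \<inter> X = {}" "has_tail_in r C"
proof -
  let ?\<omega> = "ray_equiv G `` {r}"
  obtain D where D: "D \<in> graph_components (induced G (verts G - X))" "has_tail_in r D"
    using ray_tail_in_component[OF G r X(1)] .
  have \<omega>: "?\<omega> \<in> ends G" "r \<in> ?\<omega>"
    using r ray_equiv_refl[OF r] by (auto simp: ends_def quotient_def)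
  have lives: "lives_in ?\<omega> D"
    unfolding lives_in_def
  proof
    fix s assume "s \<in> ?\<omega>"
    then have s: "ray G s" "\<not> separates_rays G X r s"
      using X by (auto simp: ray_equiv_def)
    \<comment> \<open>The ray \<open>s\<close> has a tail in some component too; if that were not
      \<open>D\<close>, the set \<open>X\<close> would separate \<open>r\<close> from
      \<open>s\<close>.\<close>
    obtain E where "E \<in> graph_components (induced G (verts G - X))" "has_tail_in s E"
      using ray_tail_in_component[OF G s(1) X(1)] .
    then show "has_tail_in s D"
      using s(2) D by (auto simp: separates_rays_def)
  qed
  have "hat G D \<in> end_neighbourhoods G"
    unfolding end_neighbourhoods_def using X \<omega>(1) D(1) lives by blast
  then have "openin (freudenthal G) (hat G D)"
    unfolding freudenthal_def by (intro topology_generated_by_Basis) blast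
  then have "(arbitrary union_of (\<lambda>U. U \<in> hat G ` \<C> \<union> open_stars G \<union> open_edge_intervals G)) (hat G D)"
    using basis unfolding defines_basis_def by simp
  then obtain \<U> where \<U>: "\<U> \<subseteq> hat G ` \<C> \<union> open_stars G \<union> open_edge_intervals G" "\<Union>\<U> = hat G D"
    by (auto simp: union_of_def arbitrary_def)
  have "End ?\<omega> \<in> hat G D"
    using \<omega>(1) lives by (auto simp: hat_def)
  then obtain B where B: "B \<in> \<U>" "End ?\<omega> \<in> B" using \<U>(2) by blast
  \<comment> \<open>Stars and edge intervals contain no ends, which leaves only the form
    \<open>hat G C\<close> for \<open>B\<close>.\<close>
  have "B \<notin> open_stars G" "B \<notin> open_edge_intervals G"
    using B(2) by (auto simp: open_stars_def open_star_def open_edge_intervals_def open_edge_interval_def)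
  then obtain C where C: "C \<in> \<C>" "B = hat G C" using B(1) \<U>(1) by blast
  have "hat G C \<subseteq> hat G D" using B(1) C(2) \<U>(2) by blast
  then have "C \<subseteq> D" using hat_subset_imp_subset reg C(1) by (metis region_def)
  moreover have "D \<inter> X = {}"
  proof -
    obtain u where "u \<in> verts G - X" "D = {v. reachable (induced G (verts G - X)) u v}"
      using D(1) by (auto simp: graph_components_def induced_def)
    then have "v \<in> verts (induced G (verts G - X))" if "v \<in> D" for v
      using that reachable_in_verts[OF simple_graph_induced[OF G]] by (auto simp: induced_def)
    then show ?thesis by (auto simp: induced_def)
  qed
  moreover have "has_tail_in r C"
    using B(2) C(2) \<omega>(2) by (auto simp: hat_def lives_in_def)
  ultimately show thesis using that C(1) by blast
qed

section \<open>Covering a component up to finitely many vertices\<close>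

text \<open>The finite error makes every finite set coverable by the empty family, so coverability
  passes through finitely branching unions.\<close>

definition coverable :: "'a set set \<Rightarrow> 'a set \<Rightarrow> bool" where
  "coverable \<D> A \<longleftrightarrow> (\<exists>F\<subseteq>\<D>. finite F \<and> finite (A - \<Union>F))"

lemma coverable_finite: "finite A \<Longrightarrow> coverable \<D> A"
  unfolding coverable_def by (intro exI[of _ "{}"]) auto

lemma coverable_subset_member: "C \<in> \<D> \<Longrightarrow> A \<subseteq> C \<Longrightarrow> coverable \<D> A"
  unfolding coverable_def by (intro exI[of _ "{C}"]) (auto simp: Diff_eq_empty_iff[THEN iffD2])

lemma coverable_Un:
  assumes "coverable \<D> A" "coverable \<D> B"
  shows "coverable \<D> (A \<union> B)"
proof -
  obtain E F where "E \<subseteq> \<D>" "finite E" "finite (A - \<Union>E)" "F \<subseteq> \<D>" "finite F" "finite (B - \<Union>F)"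
    using assms unfolding coverable_def by blast
  moreover have "A \<union> B - \<Union>(E \<union> F) \<subseteq> (A - \<Union>E) \<union> (B - \<Union>F)" by blast
  ultimately show ?thesis
    unfolding coverable_def by (intro exI[of _ "E \<union> F"]) (auto intro: finite_subset)
qed

lemma coverable_UN:
  assumes "finite I" "\<And>i. i \<in> I \<Longrightarrow> coverable \<D> (A i)"
  shows "coverable \<D> (\<Union>i\<in>I. A i)"
  using assms by (induction I rule: finite_induct) (auto intro: coverable_Un coverable_finite)

section \<open>Geodesics from a fixed vertex\<close>

text \<open>Without a walk from \<open>u\<close> to \<open>v\<close> the value is unspecified. The
  geodesic meaning enters only in \<open>reachable_away\<close>, which assumes reachability.\<close>

definition distance :: "'a graph \<Rightarrow> 'a \<Rightarrow> 'a \<Rightarrow> nat" where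
  "distance G u v = (LEAST n. ((\<lambda>x y. {x, y} \<in> edges G) ^^ n) u v)"

definition away_step :: "'a graph \<Rightarrow> 'a \<Rightarrow> 'a \<Rightarrow> 'a \<Rightarrow> bool" where
  "away_step G z u v \<longleftrightarrow> {u, v} \<in> edges G \<and> distance G z v = Suc (distance G z u)"

text \<open>Initial segments of shortest walks are shortest, so the distance from \<open>z\<close>
  grows by exactly one at each step of such a walk.\<close>

lemma reachable_away:
  assumes "reachable G z v"
  shows "(away_step G z)\<^sup>*\<^sup>* z v"
proof -
  let ?R = "\<lambda>x y. {x, y} \<in> edges G"
  have "(?R ^^ distance G z v) z v"
    using assms rtranclp_imp_relpowp[of ?R] unfolding reachable_def distance_def
    by (metis (mono_tags, lifting) LeastI_ex)
  then show ?thesis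
  proof (induction "distance G z v" arbitrary: v)
    case 0
    then show ?case by simp
  next
    case (Suc n)
    have "(?R ^^ Suc n) z v" by (subst Suc.hyps(2)) (rule Suc.prems)
    then obtain w where w: "(?R ^^ n) z w" "{w, v} \<in> edges G"
      by (rule relpowp_Suc_E)
    \<comment> \<open>The vertex \<open>w\<close> precedes \<open>v\<close> on a shortest walk; a
      walk to \<open>w\<close> of fewer than \<open>n\<close> steps would extend to one to
      \<open>v\<close> that is too short.\<close>
    have le: "distance G z w \<le> n" unfolding distance_def using w(1) by (rule Least_le)
    have d: "(?R ^^ distance G z w) z w" unfolding distance_def using w(1) by (rule LeastI)
    have "(?R ^^ Suc (distance G z w)) z v" using d w(2) by (rule relpowp_Suc_I)
    then have "distance G z v \<le> Suc (distance G z w)"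
      unfolding distance_def[of G z v] by (rule Least_le)
    then have eq: "distance G z w = n" using le Suc.hyps(2) by simp
    then have "(away_step G z)\<^sup>*\<^sup>* z w" using Suc.hyps(1) w(1) by blast
    moreover have "away_step G z w v" using w(2) eq Suc.hyps(2) by (simp add: away_step_def)
    ultimately show ?case by (rule rtranclp.rtrancl_into_rtrancl)
  qed
qed

lemma away_distance_le: "(away_step G z)\<^sup>*\<^sup>* u v \<Longrightarrow> distance G z u \<le> distance G z v"
  by (induction rule: rtranclp_induct) (auto simp: away_step_def)

lemma away_descendants_step:
  "{y. (away_step G z)\<^sup>*\<^sup>* x y} = {x} \<union> (\<Union>w\<in>Collect (away_step G z x). {y. (away_step G z)\<^sup>*\<^sup>* w y})"
  by (auto elim: converse_rtranclpE intro: converse_rtranclp_into_rtranclp)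

text \<open>If the component of \<open>z\<close> were not coverable, a geodesic ray could be grown from \<open>z\<close> whose
  vertices all have a non-coverable set of descendants. But a basic region around the end of this
  ray contains all descendants of a late vertex, since they are farther from \<open>z\<close> than its finite
  inner boundary.\<close>

lemma component_coverable:
  assumes G: "simple_graph G" "locally_finite G" and z: "z \<in> verts G"
    and X: "finite X" "X \<subseteq> verts G"
    and reg: "\<forall>C\<in>\<C>. region G C" and basis: "defines_basis G \<C>"
  shows "coverable {C \<in> \<C>. C \<inter> X = {}} {v. reachable G z v}"
proof (rule ccontr)
  let ?\<D> = "{C \<in> \<C>. C \<inter> X = {}}"
  define T where "T x = {y. (away_step G z)\<^sup>*\<^sup>* x y}" for x
  assume "\<not> ?thesis"
  moreover have "{v. reachable G z v} = T z"
  proof (intro equalityI subsetI)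
    fix v assume "v \<in> T z"
    then have "(away_step G z)\<^sup>*\<^sup>* z v" by (simp add: T_def)
    then show "v \<in> {v. reachable G z v}"
      unfolding reachable_def mem_Collect_eq
      by (rule rtranclp_mono[THEN predicate2D, rotated]) (auto simp: away_step_def)
  qed (auto simp: T_def reachable_away)
  ultimately have z0: "\<not> coverable ?\<D> (T z)" by simp
  \<comment> \<open>As in Koenig's lemma: if all of the finitely many successors of \<open>x\<close>
    had coverable descendants, so would \<open>x\<close>.\<close>
  have step: "\<exists>y. \<not> coverable ?\<D> (T y) \<and> away_step G z x y" if nc: "\<not> coverable ?\<D> (T x)" and "x \<in> verts G" for x
  proof (rule ccontr)
    assume no: "\<not> ?thesis"
    have "finite (Collect (away_step G z x))"
      using G(2) \<open>x \<in> verts G\<close> unfolding locally_finite_def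
      by (auto simp: away_step_def neighbours_def intro: finite_subset[of _ "neighbours G x"])
    then have "coverable ?\<D> ({x} \<union> (\<Union>w\<in>Collect (away_step G z x). T w))"
      using no by (intro coverable_Un coverable_UN coverable_finite[of "{x}"]) auto
    then show False
      using nc away_descendants_step[of G z x] by (simp add: T_def)
  qed
  have "\<exists>r. \<forall>n. (r n \<in> verts G \<and> \<not> coverable ?\<D> (T (r n))) \<and> away_step G z (r n) (r (Suc n))"
  proof (rule dependent_nat_choice)
    show "\<exists>x. x \<in> verts G \<and> \<not> coverable ?\<D> (T x)" using z z0 by blast
  next
    fix x n assume "x \<in> verts G \<and> \<not> coverable ?\<D> (T x)"
    then show "\<exists>y. (y \<in> verts G \<and> \<not> coverable ?\<D> (T y)) \<and> away_step G z x y"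
      using step[of x] simple_graph_edgeD(2)[OF G(1)] by (auto simp: away_step_def)
  qed
  then obtain r where r: "\<And>n. \<not> coverable ?\<D> (T (r n))" "\<And>n. away_step G z (r n) (r (Suc n))"
    by blast
  have mono: "strict_mono (\<lambda>n. distance G z (r n))"
    using r(2) by (auto simp: strict_mono_Suc_iff away_step_def)
  then have "inj r"
    by (metis (mono_tags, lifting) injI strict_mono_eq)
  then have "ray G r" using r(2) by (auto simp: ray_def away_step_def)
  then obtain C where C: "C \<in> \<C>" "C \<inter> X = {}" "has_tail_in r C"
    using basis_region_of_ray[OF G(1) _ X reg basis] by blast
  have "finite (distance G z ` V\<^sup>+ G C)"
    using reg C(1) by (auto simp: region_def)
  then obtain b where b: "\<forall>x\<in>V\<^sup>+ G C. distance G z x < b"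
    using finite_nat_set_iff_bounded by auto
  obtain n where n: "\<forall>m\<ge>n. r m \<in> C" using C(3) by (auto simp: has_tail_in_def)
  \<comment> \<open>From index \<open>n\<close> on the ray stays in \<open>C\<close>. Distances grow
    at least as fast as indices, so from \<open>b\<close> on it is farther from \<open>z\<close>
    than all of \<open>V\<^sup>+ G C\<close>.\<close>
  define m where "m = max n b"
  have "r m \<in> C" using n by (simp add: m_def)
  have "b \<le> distance G z (r m)"
    using strict_mono_imp_increasing[OF mono, of m] by (simp add: m_def)
  have "y \<in> C" if "(away_step G z)\<^sup>*\<^sup>* (r m) y" for y
    using that
  proof (induction rule: rtranclp_induct)
    case (step u v)
    have "u \<notin> V\<^sup>+ G C"
      using b away_distance_le[OF step.hyps(1)] \<open>b \<le> distance G z (r m)\<close> by fastforce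
    then show ?case
      using step.IH step.hyps(2) mem_if_not_inner_boundary[of u C G v] by (simp add: away_step_def)
  qed (fact \<open>r m \<in> C\<close>)
  then have "coverable ?\<D> (T (r m))"
    using C by (intro coverable_subset_member[of C]) (auto simp: T_def)
  then show False using r(1) by blast
qed

text \<open>Pass to the maximal members of a finite cover: each member lies below a maximal one, and
  nestedness makes distinct maximal ones disjoint.\<close>

lemma coverable_disjoint_regions:
  assumes "coverable \<D> A" "nested \<D>"
  obtains F where "F \<subseteq> \<D>" "finite F" "disjoint F" "finite (A - \<Union>F)" "\<And>C. C \<in> F \<Longrightarrow> C \<inter> A \<noteq> {}"
proof -
  obtain E where E: "E \<subseteq> \<D>" "finite E" "finite (A - \<Union>E)"
    using assms(1) by (auto simp: coverable_def)
  \<comment> \<open>Members missing \<open>A\<close> do not help to cover it. Those that remain lie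
    inside \<open>A\<close> when they are connected and \<open>A\<close> is a component.\<close>
  define E' where "E' = {C \<in> E. C \<inter> A \<noteq> {}}"
  define F where "F = {C \<in> E'. \<forall>D\<in>E'. C \<subseteq> D \<longrightarrow> C = D}"
  have fin: "finite E'" using E(2) by (simp add: E'_def)
  have "disjoint F"
  proof (rule disjointI)
    fix C D assume "C \<in> F" "D \<in> F" "C \<noteq> D"
    moreover from this have "C \<inter> D = {} \<or> C \<subseteq> D \<or> D \<subseteq> C"
      using assms(2) E(1) by (auto simp: nested_def F_def E'_def)
    ultimately show "C \<inter> D = {}" by (auto simp: F_def)
  qed
  moreover have "A - \<Union>F \<subseteq> A - \<Union>E"
  proof -
    have "\<exists>D\<in>F. C \<subseteq> D" if "C \<in> E'" for C
      using finite_has_maximal2[OF fin that] by (auto simp: F_def)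
    then have "\<Union>E' \<subseteq> \<Union>F" by fast
    then show ?thesis by (auto simp: E'_def)
  qed
  ultimately show thesis
    using E fin by (intro that[of F]) (auto simp: F_def E'_def intro: finite_subset)
qed

section \<open>The finite subgraph\<close>

text \<open>\<open>W\<close> is a union of components of \<open>G\<close>: a single one for minimum degrees, all of them for
  average degrees.\<close>

locale region_cover =
  fixes G :: "'a graph" and W :: "'a set" and F :: "'a set set"
  assumes simple: "simple_graph G" and lf: "locally_finite G"
    and W: "W \<subseteq> verts G" and closed: "\<And>x y. x \<in> W \<Longrightarrow> {x, y} \<in> edges G \<Longrightarrow> y \<in> W"
    and fin: "finite F" and disj: "disjoint F" and FW: "\<Union>F \<subseteq> W"
    and reg: "\<And>C. C \<in> F \<Longrightarrow> region G C"
    and rest: "finite (W - \<Union>F)"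
begin

definition "core = W - \<Union>F"

definition "shell = (\<Union>C\<in>F. V\<^sup>+ G C)"

definition "H = induced G (core \<union> shell)"

lemma inner_boundary_subset: "V\<^sup>+ G C \<subseteq> C"
  by (auto simp: inner_boundary_def)

lemma core_shell_subset: "core \<union> shell \<subseteq> W"
  using FW inner_boundary_subset by (fastforce simp: core_def shell_def)

lemma verts_H: "verts H = core \<union> shell"
  using core_shell_subset W by (auto simp: H_def induced_def)

lemma finite_core: "finite core" using rest by (simp add: core_def)

lemma finite_inner_boundary: "C \<in> F \<Longrightarrow> finite (V\<^sup>+ G C)"
  using reg by (auto simp: region_def)

lemma finite_H: "finite (verts H)"
  using finite_core finite_inner_boundary fin by (auto simp: verts_H shell_def)

lemma subgraph_H: "subgraph H G"
  using simple by (auto simp: subgraph_def simple_graph_def H_def induced_def)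

text \<open>If \<open>w\<close> lies in some \<open>C\<close> of \<open>F\<close>, the edge to
  \<open>v\<close> leaves \<open>C\<close>, so \<open>w\<close> is on the inner boundary of
  \<open>C\<close>.\<close>

lemma core_shell_neighbour:
  assumes "w \<in> W" "{w, v} \<in> edges G" "\<And>C. C \<in> F \<Longrightarrow> w \<in> C \<Longrightarrow> v \<notin> C"
  shows "w \<in> core \<union> shell"
  using assms by (auto simp: core_def shell_def inner_boundary_def neighbours_def)

lemma degree_core:
  assumes "v \<in> core"
  shows "degree H v = degree G v"
proof -
  have "w \<in> core \<union> shell" if "{v, w} \<in> edges G" for w
    using assms that closed[OF _ that]
    by (intro core_shell_neighbour[of w v]) (auto simp: core_def insert_commute)
  then have "neighbours H v = neighbours G v"
    using assms by (auto simp: neighbours_def H_def induced_def)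
  then show ?thesis by (simp add: degree_def)
qed

text \<open>A neighbour of \<open>v\<close> in the boundary graph is either in
  \<open>V\<^sup>+ G C\<close> or outside \<open>C\<close>. In the latter case disjointness of
  \<open>F\<close> keeps it from sharing a region with \<open>v\<close>, so
  \<open>core_shell_neighbour\<close> applies.\<close>

lemma degree_shell:
  assumes "C \<in> F" "v \<in> V\<^sup>+ G C"
  shows "degree (boundary_graph G C) v \<le> degree H v"
proof -
  have v: "v \<in> C" "v \<in> shell" "v \<in> W"
    using assms inner_boundary_subset core_shell_subset by (auto simp: shell_def)
  have "w \<in> core \<union> shell" if "{v, w} \<in> edges G" "w \<notin> C" for w
  proof (rule core_shell_neighbour[of w v])
    show "w \<in> W" using closed v(3) that(1) .
    show "{w, v} \<in> edges G" using that(1) by (simp add: insert_commute)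
    show "v \<notin> D" if "D \<in> F" "w \<in> D" for D
      using disj that \<open>w \<notin> C\<close> v(1) assms(1) by (auto dest: disjointD)
  qed
  moreover have "V\<^sup>+ G C \<subseteq> shell" using assms(1) by (auto simp: shell_def)
  ultimately have "neighbours (boundary_graph G C) v \<subseteq> neighbours H v"
    using v(2) by (auto simp: neighbours_def boundary_graph_def H_def induced_def outer_boundary_def)
  moreover have "finite (neighbours H v)"
    using lf v(3) W by (auto simp: locally_finite_def neighbours_def H_def induced_def
        intro: finite_subset[of _ "neighbours G v"])
  ultimately show ?thesis by (simp add: degree_def card_mono)
qed

lemma min_degree_H:
  assumes "core \<noteq> {}" "\<And>v. v \<in> core \<Longrightarrow> k \<le> degree G v"
    and "\<And>C. C \<in> F \<Longrightarrow> V\<^sup>+ G C \<noteq> {} \<Longrightarrow> k \<le> \<delta>\<^sup>+ G C"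
  shows "k \<le> min_degree H"
  unfolding min_degree_def
proof (rule cINF_greatest)
  show "verts H \<noteq> {}" using assms(1) by (simp add: verts_H)
  fix v assume "v \<in> verts H"
  then consider "v \<in> core" | C where "C \<in> F" "v \<in> V\<^sup>+ G C"
    by (auto simp: verts_H shell_def)
  then show "k \<le> degree H v"
  proof cases
    case 1
    then show ?thesis using assms(2) degree_core by simp
  next
    case 2
    then have "k \<le> \<delta>\<^sup>+ G C" using assms(3) by blast
    also have "\<dots> \<le> degree (boundary_graph G C) v"
      unfolding min_boundary_degree_def using 2 by (auto intro: cINF_lower)
    finally show ?thesis using degree_shell[OF 2] by simp
  qed
qed

text \<open>The core and the inner boundaries partition the vertices of \<open>H\<close>, so degree
  sums can be compared with sums of the constant \<open>q\<close> piece by piece.\<close>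

lemma avg_degree_H:
  assumes "core \<noteq> {}" "F \<noteq> {}" and avg: "q \<le> avg_degree_on G core"
    and "\<And>C. C \<in> F \<Longrightarrow> V\<^sup>+ G C \<noteq> {}" "\<And>C. C \<in> F \<Longrightarrow> q < d\<^sup>+ G C"
  shows "q < avg_degree H"
proof -
  let ?d = "\<lambda>v. of_nat (degree H v) :: rat"
  have "core \<inter> shell = {}"
    using inner_boundary_subset by (fastforce simp: core_def shell_def)
  moreover have fs: "finite shell" using finite_H by (simp add: verts_H)
  ultimately have split: "sum f (verts H) = sum f core + sum f shell" for f :: "'a \<Rightarrow> rat"
    using finite_core by (simp add: verts_H sum.union_disjoint)
  have shell: "sum f shell = (\<Sum>C\<in>F. sum f (V\<^sup>+ G C))" for f :: "'a \<Rightarrow> rat"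
    unfolding shell_def
  proof (rule sum.UNION_disjoint[OF fin])
    show "\<forall>C\<in>F. finite (V\<^sup>+ G C)" using finite_inner_boundary by blast
    show "\<forall>C\<in>F. \<forall>D\<in>F. C \<noteq> D \<longrightarrow> V\<^sup>+ G C \<inter> V\<^sup>+ G D = {}"
      using disj by (auto simp: inner_boundary_def dest: disjointD)
  qed
  have "q * of_nat (card core) \<le> (\<Sum>v\<in>core. of_nat (degree G v))"
    using avg assms(1) finite_core by (simp add: avg_degree_on_def pos_le_divide_eq card_gt_0_iff)
  also have "\<dots> = sum ?d core" by (simp add: degree_core)
  finally have core: "(\<Sum>v\<in>core. q) \<le> sum ?d core" by (simp add: mult.commute)
  have "(\<Sum>v\<in>V\<^sup>+ G C. q) < sum ?d (V\<^sup>+ G C)" if "C \<in> F" for C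
  proof -
    have "0 < card (V\<^sup>+ G C)"
      using assms(4) that finite_inner_boundary by (simp add: card_gt_0_iff)
    then have "q * of_nat (card (V\<^sup>+ G C)) < (\<Sum>v\<in>V\<^sup>+ G C. of_nat (degree (boundary_graph G C) v))"
      using assms(5)[OF that] by (simp add: avg_boundary_degree_def avg_degree_on_def pos_less_divide_eq)
    also have "\<dots> \<le> sum ?d (V\<^sup>+ G C)"
      using degree_shell[OF that] by (intro sum_mono) simp
    finally show ?thesis by (simp add: mult.commute)
  qed
  \<comment> \<open>The strict inequality arises here, from at least one region in \<open>F\<close>;
    the core contributes only a weak one.\<close>
  then have "(\<Sum>v\<in>shell. q) < sum ?d shell"
    unfolding shell by (rule sum_strict_mono[OF fin assms(2)])
  then have "(\<Sum>v\<in>verts H. q) < sum ?d (verts H)"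
    using core by (simp only: split)
  moreover have "0 < card (verts H)"
    using assms(1) finite_H by (simp add: card_gt_0_iff verts_H)
  ultimately show ?thesis
    by (simp add: avg_degree_def avg_degree_on_def pos_less_divide_eq mult.commute)
qed

end

text \<open>The guards on \<open>V\<^sup>+ G C\<close> exempt regions that are whole components,
  where minimum and average range over the empty set. In (ii), finitely many components let finitely
  many covers exhaust \<open>verts G\<close>.\<close>

theorem theorem4:
  fixes G :: "'a graph" and \<C> :: "'a set set" and k :: nat and q :: rat
  assumes "simple_graph G" and "locally_finite G" and "infinite (verts G)"
    and "\<forall>C\<in>\<C>. region G C" and "nested \<C>" and "defines_basis G \<C>"
  shows "(min_degree G \<ge> k \<and> (\<forall>C\<in>\<C>. V\<^sup>+ G C \<noteq> {} \<longrightarrow> \<delta>\<^sup>+ G C \<ge> k)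
            \<longrightarrow> (\<exists>H. subgraph H G \<and> finite (verts H) \<and> verts H \<noteq> {} \<and> min_degree H \<ge> k))
       \<and> (finite (graph_components G)
            \<and> (\<exists>S\<^sub>0. finite S\<^sub>0 \<and> S\<^sub>0 \<subseteq> verts G \<and>
                 (\<forall>S. finite S \<and> S \<noteq> {} \<and> S\<^sub>0 \<subseteq> S \<and> S \<subseteq> verts G \<longrightarrow> avg_degree_on G S \<ge> q))
            \<and> (\<forall>C\<in>\<C>. V\<^sup>+ G C \<noteq> {} \<longrightarrow> d\<^sup>+ G C > q)
            \<longrightarrow> (\<exists>H. subgraph H G \<and> finite (verts H) \<and> verts H \<noteq> {} \<and> avg_degree H > q))"
proof (intro conjI impI; elim conjE exE)
  assume k: "min_degree G \<ge> k" and \<delta>: "\<forall>C\<in>\<C>. V\<^sup>+ G C \<noteq> {} \<longrightarrow> \<delta>\<^sup>+ G C \<ge> k"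
  obtain z where z: "z \<in> verts G"
    using assms(3) infinite_imp_nonempty by blast
  define W where "W = {v. reachable G z v}"
  \<comment> \<open>Regions avoiding \<open>z\<close> leave \<open>z\<close> in the core, so
    \<open>H\<close> has a vertex.\<close>
  have "coverable {C \<in> \<C>. C \<inter> {z} = {}} W"
    unfolding W_def using assms z by (intro component_coverable) auto
  moreover have "nested {C \<in> \<C>. C \<inter> {z} = {}}" using assms(5) by (simp add: nested_def)
  ultimately obtain F where F: "F \<subseteq> {C \<in> \<C>. C \<inter> {z} = {}}" "finite F" "disjoint F"
      "finite (W - \<Union>F)" "\<And>C. C \<in> F \<Longrightarrow> C \<inter> W \<noteq> {}"
    using coverable_disjoint_regions by blast
  interpret region_cover G W F
  proof
    show "W \<subseteq> verts G"
      using z reachable_in_verts[OF assms(1)] by (auto simp: W_def)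
    show "y \<in> W" if "x \<in> W" "{x, y} \<in> edges G" for x y
      using that reachable_step[of G z x y] by (simp add: W_def)
    \<comment> \<open>Each region in \<open>F\<close> is connected and meets the component
      \<open>W\<close>, hence lies in it.\<close>
    show "\<Union>F \<subseteq> W"
    proof
      fix v assume "v \<in> \<Union>F"
      then obtain C u where "C \<in> F" "v \<in> C" "u \<in> C" "u \<in> W" using F(5) by blast
      moreover from this have "reachable G u v"
        using F(1) assms(4) by (intro region_reachable[of G C]) auto
      ultimately show "v \<in> W" using reachable_trans[of G z u v] by (simp add: W_def)
    qed
  qed (use assms F in auto)
  have "z \<in> W" by (simp add: W_def reachable_refl)
  then have "z \<in> core" using F(1) by (auto simp: core_def)
  moreover have "k \<le> degree G v" if "v \<in> core" for v
  proof -
    have "min_degree G \<le> degree G v"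
      using that core_shell_subset W by (auto simp: min_degree_def intro!: cINF_lower)
    then show ?thesis using k by simp
  qed
  ultimately have "k \<le> min_degree H"
    using F(1) \<delta> by (intro min_degree_H) auto
  then show "\<exists>H. subgraph H G \<and> finite (verts H) \<and> verts H \<noteq> {} \<and> min_degree H \<ge> k"
    using subgraph_H finite_H \<open>z \<in> core\<close> by (intro exI[of _ H]) (auto simp: verts_H)
next
  fix S\<^sub>0
  assume comps: "finite (graph_components G)" and S\<^sub>0: "finite S\<^sub>0" "S\<^sub>0 \<subseteq> verts G"
    and q: "\<forall>S. finite S \<and> S \<noteq> {} \<and> S\<^sub>0 \<subseteq> S \<and> S \<subseteq> verts G \<longrightarrow> avg_degree_on G S \<ge> q"
    and d: "\<forall>C\<in>\<C>. V\<^sup>+ G C \<noteq> {} \<longrightarrow> d\<^sup>+ G C > q"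
  \<comment> \<open>\<open>R\<close> is a finite set of representatives of the components.\<close>
  obtain R where R: "R \<subseteq> verts G" "finite R"
      "graph_components G = (\<lambda>u. {v. reachable G u v}) ` R"
    using finite_subset_image[OF comps, of "\<lambda>u. {v. reachable G u v}" "verts G"]
    unfolding graph_components_def by auto
  have ex: "\<exists>u\<in>R. reachable G u v" if "v \<in> verts G" for v
  proof -
    have "{w. reachable G v w} \<in> graph_components G" using that by (auto simp: graph_components_def)
    then obtain u where "u \<in> R" "{w. reachable G v w} = {w. reachable G u w}" using R(3) by auto
    then show ?thesis using reachable_refl[of G v] by blast
  qed
  \<comment> \<open>Meeting every component, \<open>R\<close> forces the regions avoiding it to have a nonempty boundary.\<close>
  define \<D> where "\<D> = {C \<in> \<C>. C \<inter> (S\<^sub>0 \<union> R) = {}}"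
  have "coverable \<D> (\<Union>u\<in>R. {v. reachable G u v})"
    unfolding \<D>_def using assms R S\<^sub>0 by (intro coverable_UN component_coverable) auto
  moreover have "(\<Union>u\<in>R. {v. reachable G u v}) = verts G"
    using ex R(1) reachable_in_verts[OF assms(1)] by blast
  moreover have "nested \<D>" using assms(5) by (simp add: nested_def \<D>_def)
  ultimately obtain F where F: "F \<subseteq> \<D>" "finite F" "disjoint F" "finite (verts G - \<Union>F)"
    using coverable_disjoint_regions[of \<D> "verts G"] by metis
  have FC: "F \<subseteq> \<C>" and avoid: "\<Union>F \<inter> (S\<^sub>0 \<union> R) = {}" using F(1) by (auto simp: \<D>_def)
  interpret region_cover G "verts G" F
  proof
    show "\<Union>F \<subseteq> verts G" using FC assms(4) by (auto simp: region_def)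
  qed (use assms F FC simple_graph_edgeD(2)[OF assms(1)] in auto)
  have "F \<noteq> {}" using assms(3) F(4) by auto
  have "R \<noteq> {}" using ex assms(3) infinite_imp_nonempty by blast
  \<comment> \<open>Since the core contains \<open>S\<^sub>0\<close>, the hypothesis on averages
    applies to it.\<close>
  have core: "S\<^sub>0 \<union> R \<subseteq> core" using avoid R(1) S\<^sub>0(2) by (auto simp: core_def)
  then have "core \<noteq> {}" using \<open>R \<noteq> {}\<close> by blast
  have boundary: "V\<^sup>+ G C \<noteq> {}" if "C \<in> F" for C
  proof
    assume empty: "V\<^sup>+ G C = {}"
    have "region G C" using that FC assms(4) by blast
    then obtain v where v: "v \<in> C" "v \<in> verts G"
      using region_nonempty[of G C] by (auto simp: region_def)
    then obtain u where u: "u \<in> R" "reachable G v u" using ex reachable_sym by metis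
    \<comment> \<open>With empty inner boundary \<open>C\<close> is closed under adjacency, so it
      contains the representative \<open>u\<close> of its component.\<close>
    have "u \<in> C"
      using u(2) v(1) by (rule reachable_closed) (rule mem_if_not_inner_boundary[where G = G], simp_all add: empty)
    then show False using that u(1) avoid by blast
  qed
  have "q < avg_degree H"
  proof (rule avg_degree_H)
    show "q \<le> avg_degree_on G core"
      using q core \<open>core \<noteq> {}\<close> finite_core core_shell_subset by blast
  qed (use \<open>core \<noteq> {}\<close> \<open>F \<noteq> {}\<close> boundary d FC in auto)
  then show "\<exists>H. subgraph H G \<and> finite (verts H) \<and> verts H \<noteq> {} \<and> avg_degree H > q"
    using subgraph_H finite_H \<open>core \<noteq> {}\<close> by (intro exI[of _ H]) (auto simp: verts_H)
qed

end
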